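(* Let $X,Y$ be Banach spaces, let $E:X\to Y$ be a bounded linear operator, let $A:X\supset\operatorname{dom}A\to Y$ be a closed, densely defined linear operator, and suppose there is $\mu\in\mathbb{C}$ such that $\mu E-A$ maps $\operatorname{dom}A$ bijectively onto $Y$. Let $\mathcal{A}(\lambda)=\lambda E-A$. Then $$\sigma(\mathcal{A})=\sigma(AE^{-1})=\sigma(E|_{\operatorname{dom}A}^{-1}A),$$ $$\sigma_p(\mathcal{A})=\sigma_p(AE^{-1})=\sigma_p(E|_{\operatorname{dom}A}^{-1}A),$$ $$\sigma_e(\mathcal{A})=\sigma_e(AE^{-1})=\sigma_e(E|_{\operatorname{dom}A}^{-1}A).$$
   Context: All spaces are complex; all spectra below are subsets of $\mathbb{C}\cup\{\infty\}$. Pencil: $\mathcal{A}(\lambda)=\lambda E-A$ has domain $\operatorname{dom}A$ for each $\lambda\in\mathbb{C}$. A number $\lambda\in\mathbb{C}$ belongs to $\rho(\mathcal{A})$ if $(\lambda E-A)^{-1}$ exists and is a bounded operator defined on all of $Y$; $\infty\in\rho(\mathcal{A})$ if $E$ has a bounded everywhere defined inverse and $A$ is bounded; $\sigma(\mathcal{A})=(\mathbb{C}\cup\{\infty\})\setminus\rho(\mathcal{A})$. A number $\lambda\in\mathbb{C}$ is in $\sigma_p(\mathcal{A})$ if $\ker(\lambda E-A)\ne\{0\}$, and $\infty\in\sigma_p(\mathcal{A})$ if $\ker E\cap\operatorname{dom}A\ne\{0\}$. A number $\lambda\in\mathbb{C}$ is in $\sigma_e(\mathcal{A})$ if $\mathcal{A}(\lambda)$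 is not a Fredholm operator, and $\infty\in\sigma_e(\mathcal{A})$ if $E|_{\operatorname{dom}A}:\operatorname{dom}A\to Y$ is not Fredholm (Fredholm: closed range, finite-dimensional kernel, range of finite codimension). Linear relations: a linear relation in a Banach space $Z$ is a linear subspace $\mathcal{L}\subseteq Z\times Z$; closed if it is closed in $Z\times Z$. $\mathcal{L}-\lambda=\{(x,y-\lambda x):(x,y)\in\mathcal{L}\}$, $\ker\mathcal{L}=\{x:(x,0)\in\mathcal{L}\}$, $\operatorname{mul}\mathcal{L}=\{y:(0,y)\in\mathcal{L}\}$, and $\operatorname{dom}\mathcal{L}$, $\operatorname{ran}\mathcal{L}$ are the sets of first, resp. second, components. For closed $\mathcal{L}$: $\lambda\in\mathbb{C}$ is in $\rho(\mathcal{L})$ if $\ker(\mathcal{L}-\lambda)=\{0\}$ and $\operatorname{ran}(\mathcal{L}-\lambda)=Z$; $\infty\in\rho(\mathcal{L})$ if $\operatorname{mul}\mathcal{L}=\{0\}$ and $\operatorname{dom}\mathcal{L}=Z$; $\sigma(\mathcal{L})=(\mathbb{C}\cup\{\infty\})\setminus\rho(\mathcal{L})$. $\lambda\in\mathbb{C}$ is in $\sigma_p(\mathcal{L})$ if $\ker(\mathcal{L}-\lambda)\neq\{0\}$, and $\infty\in\sigma_p(\mathcal{L})$ if $\operatorname{mul}\mathcal{L}\ne\{0\}$. $\lambda\in\mathbb{C}$ is in $\sigma_e(\mathcal{L})$ if $\operatorname{ran}(\mathcal{L}-\lambda)$ is not closed or at least one of $\ker(\mathcal{L}-\lambda)$,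 $Z/\operatorname{ran}(\mathcal{L}-\lambda)$ is infinite-dimensional; $\infty\in\sigma_e(\mathcal{L})$ if $\operatorname{dom}\mathcal{L}$ is not closed or at least one of $\operatorname{mul}\mathcal{L}$, $Z/\operatorname{dom}\mathcal{L}$ is infinite-dimensional. Kernel representation: $E|_{\operatorname{dom}A}^{-1}A=\{(x,z)\in\operatorname{dom}A\times\operatorname{dom}A: Ax=Ez\}$, a closed linear relation in the Banach space $\operatorname{dom}A$ equipped with the graph norm $\|x\|_A=\|x\|+\|Ax\|$. Range representation: $AE^{-1}=\{(Ey,Ay): y\in\operatorname{dom}A\}$, a closed linear relation in $Y$. *)

theory Defs
  imports "HOL-Analysis.Analysis"
begin

section \<open>Complex Banach spaces\<close>

class complex_vector = real_vector +
  fixes scaleC :: "complex \<Rightarrow> 'a \<Rightarrow> 'a" (infixr "*\<^sub>C" 75)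
  assumes scaleC_add_right: "a *\<^sub>C (x + y) = a *\<^sub>C x + a *\<^sub>C y"
    and scaleC_add_left: "(a + b) *\<^sub>C x = a *\<^sub>C x + b *\<^sub>C x"
    and scaleC_scaleC: "a *\<^sub>C (b *\<^sub>C x) = (a * b) *\<^sub>C x"
    and scaleC_one: "1 *\<^sub>C x = x"
    and scaleR_scaleC: "r *\<^sub>R x = complex_of_real r *\<^sub>C x"

class cbanach = complex_vector + banach +
  assumes norm_scaleC: "norm (a *\<^sub>C x) = cmod a * norm x"

global_interpretation complex_vector:
  vector_space "scaleC :: complex \<Rightarrow> 'a \<Rightarrow> 'a::complex_vector"
  defines csubspace = complex_vector.subspace
    and cspan = complex_vector.span
  by unfold_locales
    (simp_all add: scaleC_add_right scaleC_add_left scaleC_scaleC scaleC_one)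

instantiation complex :: cbanach
begin

definition "scaleC_complex (a::complex) x = a * x"

instance
  by standard (simp_all add: scaleC_complex_def algebra_simps norm_mult scaleR_conv_of_real)

end

definition cfinite_dim :: "'a::complex_vector set \<Rightarrow> bool" where
  "cfinite_dim V \<longleftrightarrow> (\<exists>B. finite B \<and> B \<subseteq> V \<and> V \<subseteq> cspan B)"

text \<open>
  The quotient \<open>Z / R\<close> is finite-dimensional: it is spanned by the classes of
  finitely many elements of \<open>Z\<close>.
\<close>

definition cfinite_codim :: "'a::complex_vector set \<Rightarrow> 'a set \<Rightarrow> bool" where
  "cfinite_codim Z R \<longleftrightarrow>
     (\<exists>B. finite B \<and> B \<subseteq> Z \<and> (\<forall>z\<in>Z. \<exists>b\<in>cspan B. z - b \<in> R))"

section \<open>Linear operators\<close>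

definition bounded_clinear :: "('a::cbanach \<Rightarrow> 'b::cbanach) \<Rightarrow> bool" where
  "bounded_clinear T \<longleftrightarrow>
     Vector_Spaces.linear scaleC scaleC T \<and> (\<exists>K. \<forall>x. norm (T x) \<le> K * norm x)"

text \<open>
  An operator \<open>A\<close> with domain \<open>D\<close> is represented by a total function whose
  values outside \<open>D\<close> are irrelevant: none of the definitions below refers to them.
\<close>

definition linear_operator :: "'a::cbanach set \<Rightarrow> ('a \<Rightarrow> 'b::cbanach) \<Rightarrow> bool" where
  "linear_operator D A \<longleftrightarrow> csubspace D \<and>
     (\<forall>x\<in>D. \<forall>y\<in>D. A (x + y) = A x + A y) \<and>
     (\<forall>c. \<forall>x\<in>D. A (c *\<^sub>C x) = c *\<^sub>C A x)"

definition closed_operator :: "'a::cbanach set \<Rightarrow> ('a \<Rightarrow> 'b::cbanach) \<Rightarrow> bool" where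
  "closed_operator D A \<longleftrightarrow> linear_operator D A \<and> closed {(x, A x) | x. x \<in> D}"

definition densely_defined :: "'a::cbanach set \<Rightarrow> bool" where
  "densely_defined D \<longleftrightarrow> closure D = UNIV"

definition bounded_operator :: "'a::cbanach set \<Rightarrow> ('a \<Rightarrow> 'b::cbanach) \<Rightarrow> bool" where
  "bounded_operator D A \<longleftrightarrow> (\<exists>K. \<forall>x\<in>D. norm (A x) \<le> K * norm x)"

definition op_ker :: "'a set \<Rightarrow> ('a \<Rightarrow> 'b::zero) \<Rightarrow> 'a set" where
  "op_ker D T = {x \<in> D. T x = 0}"

definition fredholm :: "'a::cbanach set \<Rightarrow> ('a \<Rightarrow> 'b::cbanach) \<Rightarrow> bool" where
  "fredholm D T \<longleftrightarrow>
     closed (T ` D) \<and> cfinite_dim (op_ker D T) \<and> cfinite_codim UNIV (T ` D)"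

definition boundedly_invertible :: "'a::cbanach set \<Rightarrow> ('a \<Rightarrow> 'b::cbanach) \<Rightarrow> bool" where
  "boundedly_invertible D T \<longleftrightarrow> bij_betw T D UNIV \<and> bounded_clinear (inv_into D T)"

section \<open>Spectra of operator pencils\<close>

datatype extended_complex = Fin complex | Infty

definition pencil :: "('a \<Rightarrow> 'b::cbanach) \<Rightarrow> ('a \<Rightarrow> 'b) \<Rightarrow> complex \<Rightarrow> 'a \<Rightarrow> 'b" where
  "pencil E A \<zeta> = (\<lambda>x. \<zeta> *\<^sub>C E x - A x)"

definition pencil_resolvent_set ::
    "('a::cbanach \<Rightarrow> 'b::cbanach) \<Rightarrow> 'a set \<Rightarrow> ('a \<Rightarrow> 'b) \<Rightarrow> extended_complex set" where
  "pencil_resolvent_set E D A = {z. case z of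
       Fin \<zeta> \<Rightarrow> boundedly_invertible D (pencil E A \<zeta>)
     | Infty \<Rightarrow> boundedly_invertible UNIV E \<and> bounded_operator D A}"

definition pencil_spectrum ::
    "('a::cbanach \<Rightarrow> 'b::cbanach) \<Rightarrow> 'a set \<Rightarrow> ('a \<Rightarrow> 'b) \<Rightarrow> extended_complex set" where
  "pencil_spectrum E D A = UNIV - pencil_resolvent_set E D A"

definition pencil_point_spectrum ::
    "('a::cbanach \<Rightarrow> 'b::cbanach) \<Rightarrow> 'a set \<Rightarrow> ('a \<Rightarrow> 'b) \<Rightarrow> extended_complex set" where
  "pencil_point_spectrum E D A = {z. case z of
       Fin \<zeta> \<Rightarrow> op_ker D (pencil E A \<zeta>) \<noteq> {0}
     | Infty \<Rightarrow> op_ker UNIV E \<inter> D \<noteq> {0}}"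

definition pencil_essential_spectrum ::
    "('a::cbanach \<Rightarrow> 'b::cbanach) \<Rightarrow> 'a set \<Rightarrow> ('a \<Rightarrow> 'b) \<Rightarrow> extended_complex set" where
  "pencil_essential_spectrum E D A = {z. case z of
       Fin \<zeta> \<Rightarrow> \<not> fredholm D (pencil E A \<zeta>)
     | Infty \<Rightarrow> \<not> fredholm D E}"

section \<open>Spectra of linear relations\<close>

text \<open>
  A Banach space inside a complex vector space is given by its carrier \<open>Z\<close> (a
  complex subspace) and a norm \<open>p\<close> on \<open>Z\<close>; this covers both a whole space,
  \<open>(UNIV, norm)\<close>, and an operator domain with its graph norm.
  Domain and range of a relation are \<open>Domain\<close> and \<open>Range\<close>.
\<close>

definition norm_dist :: "'a::ab_group_add set \<Rightarrow> ('a \<Rightarrow> real) \<Rightarrow> 'a \<Rightarrow> 'a \<Rightarrow> real" where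
  "norm_dist Z p x y = (if x \<in> Z \<and> y \<in> Z then p (x - y) else 0)"
  \<comment> \<open>the default value makes \<open>norm_dist Z p\<close> symmetric also outside \<open>Z\<close>, as \<open>Metric_space\<close> demands\<close>

definition norm_topology :: "'a::ab_group_add set \<Rightarrow> ('a \<Rightarrow> real) \<Rightarrow> 'a topology" where
  "norm_topology Z p = Metric_space.mtopology Z (norm_dist Z p)"

definition closed_linear_relation ::
    "'a::complex_vector set \<Rightarrow> ('a \<Rightarrow> real) \<Rightarrow> ('a \<times> 'a) set \<Rightarrow> bool" where
  "closed_linear_relation Z p L \<longleftrightarrow>
     L \<subseteq> Z \<times> Z \<and> (0, 0) \<in> L \<and>
     (\<forall>x y u v. (x, y) \<in> L \<longrightarrow> (u, v) \<in> L \<longrightarrow> (x + u, y + v) \<in> L) \<and>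
     (\<forall>c x y. (x, y) \<in> L \<longrightarrow> (c *\<^sub>C x, c *\<^sub>C y) \<in> L) \<and>
     closedin (prod_topology (norm_topology Z p) (norm_topology Z p)) L"

definition rel_shift :: "('a::complex_vector \<times> 'a) set \<Rightarrow> complex \<Rightarrow> ('a \<times> 'a) set" where
  "rel_shift L \<zeta> = {(x, y - \<zeta> *\<^sub>C x) | x y. (x, y) \<in> L}"

definition rel_ker :: "('a \<times> 'a::zero) set \<Rightarrow> 'a set" where
  "rel_ker L = {x. (x, 0) \<in> L}"

definition rel_mul :: "('a::zero \<times> 'a) set \<Rightarrow> 'a set" where
  "rel_mul L = {y. (0, y) \<in> L}"

text \<open>
  The following notions are meaningful for \<open>closed_linear_relation Z p L\<close>.
\<close>

definition rel_resolvent_set ::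
    "'a::complex_vector set \<Rightarrow> ('a \<times> 'a) set \<Rightarrow> extended_complex set" where
  "rel_resolvent_set Z L = {z. case z of
       Fin \<zeta> \<Rightarrow> rel_ker (rel_shift L \<zeta>) = {0} \<and> Range (rel_shift L \<zeta>) = Z
     | Infty \<Rightarrow> rel_mul L = {0} \<and> Domain L = Z}"

definition rel_spectrum ::
    "'a::complex_vector set \<Rightarrow> ('a \<times> 'a) set \<Rightarrow> extended_complex set" where
  "rel_spectrum Z L = UNIV - rel_resolvent_set Z L"

definition rel_point_spectrum ::
    "('a::complex_vector \<times> 'a) set \<Rightarrow> extended_complex set" where
  "rel_point_spectrum L = {z. case z of
       Fin \<zeta> \<Rightarrow> rel_ker (rel_shift L \<zeta>) \<noteq> {0}
     | Infty \<Rightarrow> rel_mul L \<noteq> {0}}"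

definition rel_essential_spectrum ::
    "'a::complex_vector set \<Rightarrow> ('a \<Rightarrow> real) \<Rightarrow> ('a \<times> 'a) set \<Rightarrow> extended_complex set" where
  "rel_essential_spectrum Z p L = {z. case z of
       Fin \<zeta> \<Rightarrow>
         \<not> closedin (norm_topology Z p) (Range (rel_shift L \<zeta>)) \<or>
         \<not> cfinite_dim (rel_ker (rel_shift L \<zeta>)) \<or>
         \<not> cfinite_codim Z (Range (rel_shift L \<zeta>))
     | Infty \<Rightarrow>
         \<not> closedin (norm_topology Z p) (Domain L) \<or>
         \<not> cfinite_dim (rel_mul L) \<or>
         \<not> cfinite_codim Z (Domain L)}"

section \<open>Kernel and range representation\<close>

definition graph_norm :: "('a::cbanach \<Rightarrow> 'b::cbanach) \<Rightarrow> 'a \<Rightarrow> real" where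
  "graph_norm A x = norm x + norm (A x)"

definition kernel_rep ::
    "('a \<Rightarrow> 'b) \<Rightarrow> 'a set \<Rightarrow> ('a \<Rightarrow> 'b) \<Rightarrow> ('a \<times> 'a) set" where
  "kernel_rep E D A = {(x, z) | x z. x \<in> D \<and> z \<in> D \<and> A x = E z}"

definition range_rep ::
    "('a \<Rightarrow> 'b) \<Rightarrow> 'a set \<Rightarrow> ('a \<Rightarrow> 'b) \<Rightarrow> ('b \<times> 'b) set" where
  "range_rep E D A = {(E y, A y) | y. y \<in> D}"

section \<open>The representations are closed linear relations\<close>

lemma norm_topology_UNIV_norm:
  "norm_topology UNIV (norm :: 'a::real_normed_vector \<Rightarrow> real) = euclidean"
proof -
  have "norm_dist UNIV (norm :: 'a \<Rightarrow> real) = dist"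
    by (simp add: fun_eq_iff dist_norm norm_dist_def)
  then show ?thesis
    by (simp add: norm_topology_def mtopology_is_euclidean)
qed

lemma linear_operator_diff:
  assumes "linear_operator D A" "x \<in> D" "y \<in> D"
  shows "x - y \<in> D" "A (x - y) = A x - A y"
proof -
  have D: "csubspace D" using assms by (simp add: linear_operator_def)
  show xy: "x - y \<in> D" by (rule complex_vector.subspace_diff[OF D assms(2,3)])
  have "A ((x - y) + y) = A (x - y) + A y"
    using assms xy unfolding linear_operator_def by blast
  then show "A (x - y) = A x - A y" by (simp add: algebra_simps)
qed

lemma linear_operator_zero:
  assumes "linear_operator D A"
  shows "0 \<in> D" "A 0 = 0"
proof -
  show 0: "0 \<in> D" using assms complex_vector.subspace_0 by (auto simp: linear_operator_def)
  show "A 0 = 0" using linear_operator_diff(2)[OF assms 0 0] by simp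
qed

lemma norm_dist_graph_norm:
  assumes "linear_operator D A" "x \<in> D" "y \<in> D"
  shows "norm_dist D (graph_norm A) x y = dist x y + dist (A x) (A y)"
  using assms by (simp add: norm_dist_def graph_norm_def linear_operator_diff dist_norm)

lemma graph_norm_Metric_space:
  assumes "linear_operator D A"
  shows "Metric_space D (norm_dist D (graph_norm A))"
proof
  fix x y
  show "0 \<le> norm_dist D (graph_norm A) x y"
    by (simp add: norm_dist_def graph_norm_def)
  show "norm_dist D (graph_norm A) x y = norm_dist D (graph_norm A) y x"
  proof (cases "x \<in> D \<and> y \<in> D")
    case True
    then show ?thesis by (simp add: norm_dist_graph_norm[OF assms] dist_commute)
  next
    case False
    then show ?thesis by (auto simp: norm_dist_def)
  qed
next
  fix x y assume "x \<in> D" "y \<in> D"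
  then show "(norm_dist D (graph_norm A) x y = 0) = (x = y)"
    by (auto simp: norm_dist_graph_norm[OF assms] add_nonneg_eq_0_iff)
next
  fix x y z assume "x \<in> D" "y \<in> D" "z \<in> D"
  then show "norm_dist D (graph_norm A) x z
      \<le> norm_dist D (graph_norm A) x y + norm_dist D (graph_norm A) y z"
    using dist_triangle[of x z y] dist_triangle[of "A x" "A z" "A y"]
    by (simp add: norm_dist_graph_norm[OF assms])
qed

lemma graph_norm_mcomplete:
  assumes A: "closed_operator D A"
  shows "Metric_space.mcomplete D (norm_dist D (graph_norm A))"
proof -
  have lin: "linear_operator D A" and cl: "closed {(x, A x) | x. x \<in> D}"
    using A by (auto simp: closed_operator_def)
  interpret Metric_space D "norm_dist D (graph_norm A)"
    by (rule graph_norm_Metric_space[OF lin])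
  show ?thesis
    unfolding mcomplete_def
  proof (intro allI impI)
    fix s assume s: "MCauchy s"
    then have sD: "s n \<in> D" for n by (auto simp: MCauchy_def)
    have C: "\<exists>N. \<forall>m\<ge>N. \<forall>n\<ge>N. dist (s m) (s n) + dist (A (s m)) (A (s n)) < e"
      if "e > 0" for e
      using s that by (auto simp: MCauchy_def norm_dist_graph_norm[OF lin sD sD])
    have "Cauchy s" unfolding Cauchy_def
    proof (intro allI impI)
      fix e :: real assume "e > 0"
      then obtain N where N: "\<forall>m\<ge>N. \<forall>n\<ge>N. dist (s m) (s n) + dist (A (s m)) (A (s n)) < e"
        using C by blast
      have "dist (s m) (s n) < e" if "m \<ge> N" "n \<ge> N" for m n
        using N[rule_format, OF that] zero_le_dist[of "A (s m)" "A (s n)"] by linarith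
      then show "\<exists>N. \<forall>m\<ge>N. \<forall>n\<ge>N. dist (s m) (s n) < e" by blast
    qed
    then obtain x where x: "s \<longlonglongrightarrow> x" using Cauchy_convergent convergent_def by blast
    have "Cauchy (\<lambda>n. A (s n))" unfolding Cauchy_def
    proof (intro allI impI)
      fix e :: real assume "e > 0"
      then obtain N where N: "\<forall>m\<ge>N. \<forall>n\<ge>N. dist (s m) (s n) + dist (A (s m)) (A (s n)) < e"
        using C by blast
      have "dist (A (s m)) (A (s n)) < e" if "m \<ge> N" "n \<ge> N" for m n
        using N[rule_format, OF that] zero_le_dist[of "s m" "s n"] by linarith
      then show "\<exists>N. \<forall>m\<ge>N. \<forall>n\<ge>N. dist (A (s m)) (A (s n)) < e" by blast
    qed
    then obtain y where y: "(\<lambda>n. A (s n)) \<longlonglongrightarrow> y" using Cauchy_convergent convergent_def by blast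
    have "(\<lambda>n. (s n, A (s n))) \<longlonglongrightarrow> (x, y)" by (intro tendsto_Pair x y)
    moreover have "(s n, A (s n)) \<in> {(x, A x) | x. x \<in> D}" for n using sD by blast
    ultimately have "(x, y) \<in> {(x, A x) | x. x \<in> D}"
      by (rule closed_sequentially[OF cl, rotated])
    then have xD: "x \<in> D" and y_eq: "y = A x" by auto
    have "(\<lambda>n. dist (s n) x + dist (A (s n)) (A x)) \<longlonglongrightarrow> 0 + 0"
      using x y unfolding y_eq by (intro tendsto_add tendsto_dist_iff[THEN iffD1])
    then have "(\<lambda>n. norm_dist D (graph_norm A) (s n) x) \<longlonglongrightarrow> 0"
      by (simp add: norm_dist_graph_norm[OF lin sD xD])
    then show "\<exists>x. limitin mtopology s x sequentially"
      using xD sD by (auto simp: limitin_metric_dist_null)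
  qed
qed

lemma topspace_graph_topology:
  assumes "linear_operator D A"
  shows "topspace (norm_topology D (graph_norm A)) = D"
  by (simp add: norm_topology_def Metric_space.topspace_mtopology[OF graph_norm_Metric_space[OF assms]])

lemma continuous_map_graph_topology:
  assumes lin: "linear_operator D A" and f: "\<And>x y. x \<in> D \<Longrightarrow> y \<in> D \<Longrightarrow>
    dist (f x) (f y) \<le> dist x y + dist (A x) (A y)"
  shows "continuous_map (norm_topology D (graph_norm A)) euclidean (f :: _ \<Rightarrow> 'c::metric_space)"
proof -
  have "continuous_map (Metric_space.mtopology D (norm_dist D (graph_norm A)))
      (Metric_space.mtopology UNIV dist) f"
    unfolding Metric_space.metric_continuous_map[OF graph_norm_Metric_space[OF lin] Met_TC.Metric_space_axioms]
  proof (intro conjI ballI allI impI)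
    fix a and e :: real assume "a \<in> D" "e > 0"
    then show "\<exists>d>0. \<forall>x. x \<in> D \<and> norm_dist D (graph_norm A) a x < d \<longrightarrow> dist (f a) (f x) < e"
    proof (intro exI[of _ e] conjI allI impI)
      fix x assume "x \<in> D \<and> norm_dist D (graph_norm A) a x < e"
      with \<open>a \<in> D\<close> show "dist (f a) (f x) < e"
        using f[of a x] norm_dist_graph_norm[OF lin, of a x] by simp
    qed (rule \<open>e > 0\<close>)
  qed auto
  then show ?thesis by (simp add: norm_topology_def mtopology_is_euclidean)
qed

lemma bounded_clinear_linear_operator:
  assumes "bounded_clinear T"
  shows "linear_operator UNIV T" "bounded_linear T"
proof -
  obtain K where T: "Vector_Spaces.linear scaleC scaleC T" and K: "norm (T x) \<le> K * norm x" for x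
    using assms by (auto simp: bounded_clinear_def)
  interpret T: Vector_Spaces.linear scaleC scaleC T by (rule T)
  show "linear_operator UNIV T"
    by (simp add: linear_operator_def complex_vector.subspace_UNIV T.add T.scale)
  show "bounded_linear T"
    by (rule bounded_linear_intro[of _ K])
      (simp_all add: T.add T.scale scaleR_scaleC K mult.commute)
qed

lemma cbanach_scaleC_bounded_linear: "bounded_linear (\<lambda>x::'a::cbanach. c *\<^sub>C x)"
  by (rule bounded_linear_intro[of _ "cmod c"])
    (simp_all add: scaleC_add_right scaleR_scaleC scaleC_scaleC norm_scaleC mult.commute)

theorem closed_linear_relation_kernel_rep:
  assumes E: "bounded_clinear E" and A: "closed_operator D A"
  shows "closed_linear_relation D (graph_norm A) (kernel_rep E D A)"
proof -
  have lin: "linear_operator D A" using A by (simp add: closed_operator_def)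
  note linE = bounded_clinear_linear_operator(1)[OF E]
  interpret E: bounded_linear E by (rule bounded_clinear_linear_operator(2)[OF E])
  let ?T = "norm_topology D (graph_norm A)"
  have idc: "continuous_map ?T euclidean (\<lambda>x. x)" and Ac: "continuous_map ?T euclidean A"
    by (intro continuous_map_graph_topology lin; simp)+
  have Ec: "continuous_map ?T euclidean (\<lambda>x. E x)"
    using continuous_map_compose[OF idc, of euclidean E]
    by (simp add: o_def E.continuous_on continuous_on_id)
  have c: "continuous_map (prod_topology ?T ?T) euclidean (\<lambda>p. A (fst p) - E (snd p))"
    using continuous_map_compose[OF continuous_map_fst Ac]
      continuous_map_compose[OF continuous_map_snd Ec]
    by (intro continuous_map_diff) (auto simp: o_def)
  have "kernel_rep E D A = {p \<in> topspace (prod_topology ?T ?T). A (fst p) - E (snd p) \<in> {0}}"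
    by (auto simp: kernel_rep_def topspace_graph_topology[OF lin])
  then have "closedin (prod_topology ?T ?T) (kernel_rep E D A)"
    using closedin_continuous_map_preimage[OF c, of "{0}"] by simp
  moreover have "csubspace D" using lin by (simp add: linear_operator_def)
  ultimately show ?thesis
    using lin linE linear_operator_zero[OF lin] linear_operator_zero(2)[OF linE]
    unfolding closed_linear_relation_def kernel_rep_def linear_operator_def
    by (auto simp: complex_vector.subspace_add complex_vector.subspace_scale)
qed

text \<open>
  By the closed graph theorem, the hypothesis below holds as soon as \<open>pencil E A \<mu>\<close>
  maps \<open>D\<close> bijectively onto the whole space.
\<close>

theorem closed_linear_relation_range_rep:
  assumes E: "bounded_clinear E" and A: "closed_operator D A"
    and \<mu>: "boundedly_invertible D (pencil E A \<mu>)"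
  shows "closed_linear_relation UNIV norm (range_rep E D A)"
proof -
  have lin: "linear_operator D A" using A by (simp add: closed_operator_def)
  note linE = bounded_clinear_linear_operator(1)[OF E]
  interpret E: bounded_linear E by (rule bounded_clinear_linear_operator(2)[OF E])
  interpret C: bounded_linear "\<lambda>x. \<mu> *\<^sub>C x :: 'b" by (rule cbanach_scaleC_bounded_linear)
  define R where "R = inv_into D (pencil E A \<mu>)"
  have bij: "bij_betw (pencil E A \<mu>) D UNIV" using \<mu> by (simp add: boundedly_invertible_def)
  interpret R: bounded_linear R
    using \<mu> by (auto simp: boundedly_invertible_def R_def intro: bounded_clinear_linear_operator(2))
  have R1: "R y \<in> D" "\<mu> *\<^sub>C E (R y) - A (R y) = y" for y
    using bij_betw_inv_into_right[OF bij, of y] bij_betw_inv_into[OF bij]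
    by (auto simp: R_def pencil_def bij_betw_def)
  have R2: "R (\<mu> *\<^sub>C E x - A x) = x" if "x \<in> D" for x
    using bij_betw_inv_into_left[OF bij that] by (simp add: R_def pencil_def)
  have "range_rep E D A = {p. E (R (\<mu> *\<^sub>C fst p - snd p)) = fst p}"
  proof (intro set_eqI iffI)
    fix p assume "p \<in> range_rep E D A"
    then show "p \<in> {p. E (R (\<mu> *\<^sub>C fst p - snd p)) = fst p}"
      by (auto simp: range_rep_def R2)
  next
    fix p assume "p \<in> {p. E (R (\<mu> *\<^sub>C fst p - snd p)) = fst p}"
    then have "p = (E (R (\<mu> *\<^sub>C fst p - snd p)), A (R (\<mu> *\<^sub>C fst p - snd p)))"
      using R1(2)[of "\<mu> *\<^sub>C fst p - snd p"] by (auto simp: prod_eq_iff)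
    then show "p \<in> range_rep E D A"
      using R1(1) unfolding range_rep_def by blast
  qed
  moreover have "closed {p. E (R (\<mu> *\<^sub>C fst p - snd p)) = fst p}"
    by (intro closed_Collect_eq E.continuous_on R.continuous_on C.continuous_on continuous_intros)
  ultimately have "closed (range_rep E D A)" by simp
  moreover have "csubspace D" using lin by (simp add: linear_operator_def)
  moreover have "(0, 0) \<in> range_rep E D A"
    using linear_operator_zero[OF lin] linear_operator_zero(2)[OF linE]
    unfolding range_rep_def by force
  moreover have "(x + u, y + v) \<in> range_rep E D A"
    if h: "(x, y) \<in> range_rep E D A" "(u, v) \<in> range_rep E D A" for x y u v
  proof -
    obtain a b where "a \<in> D" "b \<in> D" "x = E a" "y = A a" "u = E b" "v = A b"
      using h unfolding range_rep_def by blast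
    then have "a + b \<in> D" "x + u = E (a + b)" "y + v = A (a + b)"
      using lin by (auto simp: linear_operator_def complex_vector.subspace_add E.add)
    then show ?thesis unfolding range_rep_def by blast
  qed
  moreover have "(c *\<^sub>C x, c *\<^sub>C y) \<in> range_rep E D A"
    if h: "(x, y) \<in> range_rep E D A" for c x y
  proof -
    obtain a where "a \<in> D" "x = E a" "y = A a" using h unfolding range_rep_def by blast
    then have "c *\<^sub>C a \<in> D" "c *\<^sub>C x = E (c *\<^sub>C a)" "c *\<^sub>C y = A (c *\<^sub>C a)"
      using lin linE by (auto simp: linear_operator_def complex_vector.subspace_scale)
    then show ?thesis unfolding range_rep_def by blast
  qed
  ultimately show ?thesis
    unfolding closed_linear_relation_def
    by (simp add: norm_topology_UNIV_norm euclidean_product_topology)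
qed

end

theory Submission
  imports Defs
begin

text \<open>
  Fix \<open>\<mu>\<close> such that \<open>\<mu> E - A\<close> maps \<open>D\<close> bijectively onto the whole space, and let \<open>R\<close> be the
  inverse. The kernel representation is the image of the range representation under
  \<open>R \<times> R\<close> (\<open>kernel_rep_eq_image_range_rep\<close>): since \<open>A R = \<mu> E R - 1\<close>, the operators \<open>E R\<close> and
  \<open>A R\<close> on the whole space commute, and a relation \<open>A x = E z\<close> on \<open>D\<close> says that the values of
  \<open>\<mu> E - A\<close> at \<open>x\<close> and \<open>z\<close> are \<open>E y\<close> and \<open>A y\<close> for \<open>y = \<mu> x - z\<close>. By the closed graph theorem
  \<open>R\<close> is bounded, and then it is a homeomorphism onto \<open>D\<close> with the graph norm
  (\<open>closedin_R_image_iff\<close>). So the two relations are similar and have the same spectra of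
  all three kinds.

  The pencil is then compared with whichever of the two is more convenient. At every point of the sphere, the
  relevant range of the range representation is the range of the pencil (\<open>Range_range_rep\<close>),
  and the relevant kernel of the kernel representation is the kernel of the pencil
  (\<open>rel_ker_kernel_rep\<close>). The similarity transports kernels, ranges, closedness and dimensions,
  so the pencil and both relations have the same Fredholm data.

  For the spectrum, the resolvent set of a pencil also asks for a bounded inverse. At a finite
  point this is automatic by the closed graph theorem. At infinity one has to recover from the
  bijectivity of \<open>E\<close> on \<open>D\<close> that \<open>A\<close> is bounded and hence \<open>D\<close> is everything: this is again the
  closed graph theorem, now for the operator whose graph is the range representation
  (\<open>bounded_operator_if_E_bij\<close>), together with the density of \<open>D\<close>.
\<close>

section \<open>The closed graph theorem\<close>

text \<open>
  The sets of all \<open>y\<close> with \<open>norm (f y) \<le> n\<close> cover the space, so by Baire the closure of one of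
  them contains a ball. Since these sets are convex and symmetric, the ball may be centred at
  \<open>0\<close>, and rescaling gives the approximation of every \<open>y\<close>.
\<close>

lemma closed_graph_approximation:
  fixes f :: "'a::banach \<Rightarrow> 'b::real_normed_vector"
  assumes "linear f"
  obtains C where "C > 0" "\<And>y. \<exists>z. norm (f z) \<le> C * norm y \<and> norm (y - z) \<le> norm y / 2"
proof -
  interpret f: linear f by fact
  define B where "B n = closure {y. norm (f y) \<le> real n}" for n :: nat
  have "\<exists>n. interior (B n) \<noteq> {}"
  proof (rule ccontr)
    assume "\<not> (\<exists>n. interior (B n) \<noteq> {})"
    then have "euclidean interior_of \<Union>(range B) = {}"
      by (intro Baire_category_alt) (auto simp: completely_metrizable_space_euclidean B_def)
    moreover have "\<Union>(range B) = UNIV"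
      proof -
      have "y \<in> B (nat \<lceil>norm (f y)\<rceil>)" for y
        unfolding B_def by (rule subsetD[OF closure_subset]) (simp add: real_nat_ceiling_ge)
      then show ?thesis by blast
    qed
    ultimately show False by simp
  qed
  then obtain n u0 r where r: "r > 0" and sub: "ball u0 r \<subseteq> B n"
    by (meson ex_in_conv mem_interior)
  have ball0: "\<exists>z. norm (f z) \<le> real n \<and> dist z u < e" if "norm u < r" "e > 0" for u and e :: real
  proof -
    have "u0 + u \<in> B n" "u0 - u \<in> B n" using sub that by (auto simp: dist_norm)
    then obtain a b where ab: "norm (f a) \<le> real n" "dist a (u0 + u) < e"
      "norm (f b) \<le> real n" "dist b (u0 - u) < e"
      using \<open>e > 0\<close> unfolding B_def closure_approachable by blast
    \<comment> \<open>\<open>a\<close> is near \<open>u0 + u\<close> and \<open>b\<close> is near \<open>u0 - u\<close>, so half their difference is near \<open>u\<close>\<close>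
    define z where "z = (1/2) *\<^sub>R (a - b)"
    have "norm (f z) = norm (f a - f b) / 2" by (simp add: z_def f.scale f.diff)
    also have "\<dots> \<le> real n" using ab norm_triangle_ineq4[of "f a" "f b"] by simp
    finally have "norm (f z) \<le> real n" .
    have "z - u = (1/2) *\<^sub>R ((a - (u0 + u)) - (b - (u0 - u)))"
    proof -
      have "(a - (u0 + u)) - (b - (u0 - u)) = (a - b) - (u + u)" by simp
      then show ?thesis by (simp only: z_def scaleR_diff_right scaleR_half_double)
    qed
    then have "norm (z - u) = norm ((a - (u0 + u)) - (b - (u0 - u))) / 2" by simp
    also have "\<dots> < e"
      using ab norm_triangle_ineq4[of "a - (u0 + u)" "b - (u0 - u)"] by (simp add: dist_norm)
    finally show ?thesis using \<open>norm (f z) \<le> real n\<close> by (auto simp: dist_norm)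
  qed
  define C where "C = 2 * (real n + 1) / r"
  have "\<exists>z. norm (f z) \<le> C * norm y \<and> norm (y - z) \<le> norm y / 2" for y
  proof (cases "y = 0")
    case True
    then show ?thesis by (auto intro: exI[of _ 0] simp: f.zero)
  next
    case False
    \<comment> \<open>dividing by \<open>s\<close> moves \<open>y\<close> to norm \<open>r / 2\<close>, inside the ball\<close>
    define s where "s = 2 * norm y / r"
    have s: "s > 0" using False r by (simp add: s_def)
    have "norm ((1/s) *\<^sub>R y) < r" using False r by (simp add: s_def)
    then obtain z where z: "norm (f z) \<le> real n" "dist z ((1/s) *\<^sub>R y) < r / 4"
      using ball0[of "(1/s) *\<^sub>R y" "r/4"] r by auto
    have "norm (f (s *\<^sub>R z)) = s * norm (f z)" using s by (simp add: f.scale)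
    also have "\<dots> \<le> s * (real n + 1)" using s z by (intro mult_left_mono) auto
    also have "\<dots> = C * norm y" by (simp add: s_def C_def)
    finally have 1: "norm (f (s *\<^sub>R z)) \<le> C * norm y" .
    have "y - s *\<^sub>R z = s *\<^sub>R ((1/s) *\<^sub>R y - z)" using s by (simp add: scaleR_diff_right)
    then have "norm (y - s *\<^sub>R z) = s * dist z ((1/s) *\<^sub>R y)"
      using s by (metis norm_scaleR dist_norm dist_commute abs_of_pos)
    also have "\<dots> \<le> s * (r / 4)" using s z by (intro mult_left_mono) auto
    also have "\<dots> = norm y / 2" using r by (simp add: s_def)
    finally show ?thesis using 1 by blast
  qed
  moreover have "C > 0" using r by (simp add: C_def)
  ultimately show thesis using that by blast
qed

text \<open>
  Iterating the approximation writes \<open>y\<close> as a series whose image under \<open>f\<close> converges absolutely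
  with sum of norm at most \<open>2 * C * norm y\<close>; closedness of the graph identifies that sum with
  \<open>f y\<close>.
\<close>

theorem closed_graph_theorem:
  fixes f :: "'a::banach \<Rightarrow> 'b::banach"
  assumes lin: "linear f" and graph: "closed {(y, f y) | y. True}"
  shows "bounded_linear f"
proof -
  interpret f: linear f by fact
  obtain C where C: "C > 0"
    and "\<And>y. \<exists>z. norm (f z) \<le> C * norm y \<and> norm (y - z) \<le> norm y / 2"
    using closed_graph_approximation[OF lin] by blast
  then obtain g where g: "\<And>y. norm (f (g y)) \<le> C * norm y" "\<And>y. norm (y - g y) \<le> norm y / 2"
    by metis
  have "norm (f y) \<le> (2 * C) * norm y" for y
  proof -
    \<comment> \<open>the remainder after \<open>k\<close> approximation steps\<close>
    define w where "w k = ((\<lambda>v. v - g v) ^^ k) y" for k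
    have wS: "w (Suc k) = w k - g (w k)" for k by (simp add: w_def)
    have w_le: "norm (w k) \<le> (1/2) ^ k * norm y" for k
    proof (induction k)
      case (Suc k)
      then show ?case using g(2)[of "w k"] by (simp add: wS)
    qed (simp add: w_def)
    have fg_le: "norm (f (g (w k))) \<le> C * norm y * (1/2) ^ k" for k
      using order_trans[OF g(1) mult_left_mono[OF w_le, of C]] C by (simp add: mult_ac)
    have w_eq: "(\<Sum>i<k. g (w i)) = y - w k" for k
    proof (induction k)
      case 0
      then show ?case by (simp add: w_def)
    next
      case (Suc k)
      then show ?case by (simp add: wS)
    qed
    have "(\<lambda>k. (1/2) ^ k * norm y) \<longlonglongrightarrow> 0" by (intro tendsto_mult_left_zero LIMSEQ_power_zero) simp
    then have "w \<longlonglongrightarrow> 0" by (rule Lim_null_comparison[rotated]) (simp add: w_le)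
    then have "(\<lambda>k. y - w k) \<longlonglongrightarrow> y - 0" by (intro tendsto_diff tendsto_const)
    then have S: "(\<lambda>k. \<Sum>i<k. g (w i)) \<longlonglongrightarrow> y" by (simp add: w_eq)
    have geo: "(\<lambda>k. C * norm y * (1/2) ^ k) sums (C * norm y * 2)"
      using sums_mult[OF geometric_sums[of "1/2::real"], of "C * norm y"] by simp
    have sm: "summable (\<lambda>k. norm (f (g (w k))))"
      by (rule summable_comparison_test'[OF sums_summable[OF geo]]) (simp add: fg_le)
    have "(\<lambda>k. f (\<Sum>i<k. g (w i))) \<longlonglongrightarrow> (\<Sum>i. f (g (w i)))"
      using summable_LIMSEQ[OF summable_norm_cancel[OF sm]] by (simp add: f.sum)
    with S have "(\<lambda>k. (\<Sum>i<k. g (w i), f (\<Sum>i<k. g (w i)))) \<longlonglongrightarrow> (y, \<Sum>i. f (g (w i)))"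
      by (rule tendsto_Pair)
    then have "(y, \<Sum>i. f (g (w i))) \<in> {(y, f y) | y. True}"
      by (rule closed_sequentially[OF graph, rotated]) blast
    then have "norm (f y) = norm (\<Sum>i. f (g (w i)))" by simp
    also have "\<dots> \<le> (\<Sum>i. norm (f (g (w i))))" by (rule summable_norm[OF sm])
    also have "\<dots> \<le> C * norm y * 2"
      using suminf_le[OF fg_le sm sums_summable[OF geo]] sums_unique[OF geo] by simp
    finally show ?thesis by (simp add: mult_ac)
  qed
  then show ?thesis
    by (intro bounded_linear_intro[of _ "2 * C"]) (simp_all add: f.add f.scale mult_ac)
qed

section \<open>Inverses of closed operators\<close>

lemma linear_inv_into:
  assumes T: "linear_operator D T" and bij: "bij_betw T D UNIV"
  shows "Vector_Spaces.linear scaleC scaleC (inv_into D T)"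
proof -
  have R: "inv_into D T y \<in> D" "T (inv_into D T y) = y" for y
    using bij_betw_inv_into_right[OF bij] bij_betw_inv_into[OF bij] by (auto simp: bij_betw_def)
  have R': "inv_into D T (T x) = x" if "x \<in> D" for x
    using bij_betw_inv_into_left[OF bij that] .
  have D: "csubspace D" using T by (simp add: linear_operator_def)
  show ?thesis
  proof unfold_locales
    fix a b :: 'b and c :: complex
    show "inv_into D T (a + b) = inv_into D T a + inv_into D T b"
      using R'[of "inv_into D T a + inv_into D T b"] R T complex_vector.subspace_add[OF D]
      by (simp add: linear_operator_def)
    show "inv_into D T (c *\<^sub>C a) = c *\<^sub>C inv_into D T a"
      using R'[of "c *\<^sub>C inv_into D T a"] R T complex_vector.subspace_scale[OF D]
      by (simp add: linear_operator_def)
  qed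
qed

lemma bounded_clinear_if_closed_graph:
  assumes T: "Vector_Spaces.linear scaleC scaleC T" and graph: "closed {(x, T x) | x. True}"
  shows "bounded_clinear (T :: 'a::cbanach \<Rightarrow> 'b::cbanach)"
proof -
  interpret T: Vector_Spaces.linear scaleC scaleC T by (rule T)
  have "linear T" by (rule linearI) (simp_all add: T.add T.scale scaleR_scaleC)
  then interpret B: bounded_linear T using graph by (rule closed_graph_theorem)
  show ?thesis
    unfolding bounded_clinear_def using T B.bounded by (auto simp: mult.commute)
qed

text \<open>The inverse has the flipped graph, which is closed along with the graph itself.\<close>

lemma closed_operator_boundedly_invertible_iff:
  assumes T: "closed_operator D T"
  shows "boundedly_invertible D T \<longleftrightarrow> bij_betw T D UNIV"
proof
  assume bij: "bij_betw T D UNIV"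
  have "{(y, inv_into D T y) | y. True} = prod.swap -` {(x, T x) | x. x \<in> D}"
    using bij_betw_inv_into_left[OF bij] bij_betw_inv_into_right[OF bij] bij_betw_inv_into[OF bij]
    by (auto simp: bij_betw_def)
  moreover have "closed (prod.swap -` {(x, T x) | x. x \<in> D})"
    using T by (intro closed_vimage continuous_on_swap) (simp add: closed_operator_def)
  ultimately have "bounded_clinear (inv_into D T)"
    using linear_inv_into[OF _ bij] T by (intro bounded_clinear_if_closed_graph) (simp_all add: closed_operator_def)
  with bij show "boundedly_invertible D T" by (simp add: boundedly_invertible_def)
qed (simp add: boundedly_invertible_def)

lemma closed_operator_UNIV:
  assumes "bounded_clinear T"
  shows "closed_operator UNIV T"
proof -
  interpret T: bounded_linear T by (rule bounded_clinear_linear_operator(2)[OF assms])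
  have "{(x, T x) | x. x \<in> UNIV} = {p. T (fst p) = snd p}" by auto
  then have "closed {(x, T x) | x. x \<in> UNIV}"
    by (simp add: closed_Collect_eq T.continuous_on continuous_on_fst continuous_on_snd)
  then show ?thesis
    by (simp add: closed_operator_def bounded_clinear_linear_operator(1)[OF assms])
qed

text \<open>
  Boundedness turns a convergent sequence in the domain into a Cauchy sequence of values, and the
  limit of the pairs stays in the closed graph.
\<close>

lemma closed_operator_bounded_domain:
  assumes A: "closed_operator D A" and bdd: "bounded_operator D A"
  shows "closed D"
  unfolding closed_sequential_limits
proof (intro allI impI, elim conjE)
  fix s x assume s: "\<forall>n. s n \<in> D" and x: "s \<longlonglongrightarrow> x"
  have lin: "linear_operator D A" and graph: "closed {(x, A x) | x. x \<in> D}"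
    using A by (auto simp: closed_operator_def)
  obtain K where K: "\<And>x. x \<in> D \<Longrightarrow> norm (A x) \<le> K * norm x"
    using bdd by (auto simp: bounded_operator_def)
  have "Cauchy (\<lambda>n. A (s n))"
  proof (rule metric_CauchyI)
    fix e :: real assume "e > 0"
    define d where "d = e / (\<bar>K\<bar> + 1)"
    have "d > 0" using \<open>e > 0\<close> by (simp add: d_def)
    then obtain N where N: "\<And>m n. m \<ge> N \<Longrightarrow> n \<ge> N \<Longrightarrow> dist (s m) (s n) < d"
      using metric_CauchyD[OF LIMSEQ_imp_Cauchy[OF x]] by blast
    have "dist (A (s m)) (A (s n)) < e" if "m \<ge> N" "n \<ge> N" for m n
    proof -
      have "dist (A (s m)) (A (s n)) \<le> K * norm (s m - s n)"
        using K linear_operator_diff[OF lin] s by (simp add: dist_norm flip: linear_operator_diff(2)[OF lin])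
      also have "\<dots> \<le> (\<bar>K\<bar> + 1) * norm (s m - s n)" by (intro mult_right_mono) auto
      also have "\<dots> < (\<bar>K\<bar> + 1) * d"
        using N[OF that] by (intro mult_strict_left_mono) (auto simp: dist_norm)
      also have "\<dots> = e"
      proof -
        have "\<bar>K\<bar> + 1 \<noteq> 0" by linarith
        then show ?thesis by (simp add: d_def)
      qed
      finally show ?thesis .
    qed
    then show "\<exists>M. \<forall>m\<ge>M. \<forall>n\<ge>M. dist (A (s m)) (A (s n)) < e" by blast
  qed
  then obtain y where y: "(\<lambda>n. A (s n)) \<longlonglongrightarrow> y" using Cauchy_convergent convergent_def by blast
  have "(x, y) \<in> {(x, A x) | x. x \<in> D}"
    by (rule closed_sequentially[OF graph, rotated, OF tendsto_Pair[OF x y]]) (use s in blast)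
  then show "x \<in> D" by blast
qed

section \<open>Kernels and images of partially defined operators\<close>

lemma csubspace_image:
  assumes T: "linear_operator D T"
  shows "csubspace (T ` D)"
proof (rule complex_vector.subspaceI)
  show "0 \<in> T ` D" using linear_operator_zero[OF T] by force
next
  fix x y assume "x \<in> T ` D" "y \<in> T ` D"
  then obtain u v where "u \<in> D" "v \<in> D" "x = T u" "y = T v" by blast
  then have "u + v \<in> D" "x + y = T (u + v)"
    using T by (auto simp: linear_operator_def complex_vector.subspace_add)
  then show "x + y \<in> T ` D" by blast
next
  fix c x assume "x \<in> T ` D"
  then obtain u where "u \<in> D" "x = T u" by blast
  then have "c *\<^sub>C u \<in> D" "c *\<^sub>C x = T (c *\<^sub>C u)"
    using T by (auto simp: linear_operator_def complex_vector.subspace_scale)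
  then show "c *\<^sub>C x \<in> T ` D" by blast
qed

lemma csubspace_uminus_iff:
  assumes "csubspace V"
  shows "- x \<in> V \<longleftrightarrow> x \<in> V"
  using complex_vector.subspace_neg[OF assms, of x] complex_vector.subspace_neg[OF assms, of "- x"]
  by auto

lemma inj_on_iff_op_ker:
  assumes T: "linear_operator D T"
  shows "inj_on T D \<longleftrightarrow> op_ker D T = {0}"
proof
  assume "inj_on T D"
  then show "op_ker D T = {0}"
    using linear_operator_zero[OF T] by (force simp: op_ker_def inj_on_def)
next
  assume ker: "op_ker D T = {0}"
  show "inj_on T D"
  proof (rule inj_onI)
    fix x y assume "x \<in> D" "y \<in> D" "T x = T y"
    then have "x - y \<in> op_ker D T" using linear_operator_diff[OF T] by (simp add: op_ker_def)
    then show "x = y" using ker by simp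
  qed
qed

section \<open>Finite-dimensionality under injective maps\<close>

lemma cfinite_dim_inj_image_iff:
  assumes R: "Vector_Spaces.linear scaleC scaleC R" and inj: "inj R"
  shows "cfinite_dim (R ` K) \<longleftrightarrow> cfinite_dim K"
proof -
  interpret R: Vector_Spaces.linear scaleC scaleC R by (rule R)
  have span: "cspan (R ` B) = R ` cspan B" for B using R.span_image by (simp add: cspan_def)
  show ?thesis
  proof
    assume "cfinite_dim (R ` K)"
    then obtain B where "finite B" "B \<subseteq> R ` K" "R ` K \<subseteq> cspan B" by (auto simp: cfinite_dim_def)
    moreover from this obtain B' where "B' \<subseteq> K" "finite B'" "B = R ` B'"
      using finite_subset_image by metis
    ultimately show "cfinite_dim K"
      unfolding cfinite_dim_def using span inj_image_subset_iff[OF inj] by metis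
  next
    assume "cfinite_dim K"
    then obtain B where "finite B" "B \<subseteq> K" "K \<subseteq> cspan B" by (auto simp: cfinite_dim_def)
    then have "finite (R ` B)" "R ` B \<subseteq> R ` K" "R ` K \<subseteq> cspan (R ` B)"
      unfolding span by auto
    then show "cfinite_dim (R ` K)" unfolding cfinite_dim_def by blast
  qed
qed

lemma cfinite_codim_inj_image_iff:
  assumes R: "Vector_Spaces.linear scaleC scaleC R" and inj: "inj R"
  shows "cfinite_codim (R ` Z) (R ` V) \<longleftrightarrow> cfinite_codim Z V"
proof -
  interpret R: Vector_Spaces.linear scaleC scaleC R by (rule R)
  have span: "cspan (R ` B) = R ` cspan B" for B using R.span_image by (simp add: cspan_def)
  have key: "(\<forall>z\<in>R ` Z. \<exists>b\<in>cspan (R ` B). z - b \<in> R ` V) \<longleftrightarrow> (\<forall>z\<in>Z. \<exists>b\<in>cspan B. z - b \<in> V)" for B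
    by (simp add: span inj_image_mem_iff[OF inj] flip: R.diff)
  show ?thesis
  proof
    assume "cfinite_codim (R ` Z) (R ` V)"
    then obtain B where B: "finite B" "B \<subseteq> R ` Z" "\<forall>z\<in>R ` Z. \<exists>b\<in>cspan B. z - b \<in> R ` V"
      by (auto simp: cfinite_codim_def)
    obtain B' where "B' \<subseteq> Z" "finite B'" "B = R ` B'"
      using finite_subset_image[OF B(1,2)] by metis
    with B key[of B'] show "cfinite_codim Z V" unfolding cfinite_codim_def by auto
  next
    assume "cfinite_codim Z V"
    then obtain B where "finite B" "B \<subseteq> Z" "\<forall>z\<in>Z. \<exists>b\<in>cspan B. z - b \<in> V"
      by (auto simp: cfinite_codim_def)
    with key[of B] show "cfinite_codim (R ` Z) (R ` V)"
      unfolding cfinite_codim_def by (intro exI[of _ "R ` B"]) auto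
  qed
qed

section \<open>Values at the points of the Riemann sphere\<close>

text \<open>
  At infinity, the value of a pencil is its leading coefficient and the value of a relation is its
  inverse. With these conventions the clauses for finite points and for infinity in the
  definitions of the spectra become one clause about kernel and range.
\<close>

definition pencil_at ::
    "('a \<Rightarrow> 'b::cbanach) \<Rightarrow> ('a \<Rightarrow> 'b) \<Rightarrow> extended_complex \<Rightarrow> 'a \<Rightarrow> 'b" where
  "pencil_at E A z = (case z of Fin \<zeta> \<Rightarrow> pencil E A \<zeta> | Infty \<Rightarrow> E)"

definition rel_at ::
    "('a::complex_vector \<times> 'a) set \<Rightarrow> extended_complex \<Rightarrow> ('a \<times> 'a) set" where
  "rel_at L z = (case z of Fin \<zeta> \<Rightarrow> rel_shift L \<zeta> | Infty \<Rightarrow> L\<inverse>)"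

lemma rel_resolvent_set_rel_at:
  "rel_resolvent_set Z L = {z. rel_ker (rel_at L z) = {0} \<and> Range (rel_at L z) = Z}"
  by (auto simp: rel_resolvent_set_def rel_at_def rel_ker_def rel_mul_def split: extended_complex.splits)

lemma rel_point_spectrum_rel_at:
  "rel_point_spectrum L = {z. rel_ker (rel_at L z) \<noteq> {0}}"
  by (auto simp: rel_point_spectrum_def rel_at_def rel_ker_def rel_mul_def split: extended_complex.splits)

lemma rel_essential_spectrum_rel_at:
  "rel_essential_spectrum Z p L = {z. \<not> (closedin (norm_topology Z p) (Range (rel_at L z)) \<and>
     cfinite_dim (rel_ker (rel_at L z)) \<and> cfinite_codim Z (Range (rel_at L z)))}"
  by (auto simp: rel_essential_spectrum_def rel_at_def rel_ker_def rel_mul_def split: extended_complex.splits)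

lemma rel_at_map_prod:
  assumes "Vector_Spaces.linear scaleC scaleC R"
  shows "rel_at (map_prod R R ` L) z = map_prod R R ` rel_at L z"
proof (cases z)
  case (Fin \<zeta>)
  interpret R: Vector_Spaces.linear scaleC scaleC R by (rule assms)
  have shift: "rel_shift L' \<zeta> = (\<lambda>(x, y). (x, y - \<zeta> *\<^sub>C x)) ` L'"
    for L' :: "('c::complex_vector \<times> 'c) set"
    by (force simp: rel_shift_def)
  show ?thesis
    by (simp add: Fin rel_at_def shift image_image case_prod_unfold R.diff R.scale)
next
  case Infty
  then show ?thesis by (force simp: rel_at_def)
qed

lemma Range_map_prod: "Range (map_prod R R ` L) = R ` Range L"
  by force

lemma rel_ker_map_prod:
  assumes R: "Vector_Spaces.linear scaleC scaleC R" and inj: "inj R"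
  shows "rel_ker (map_prod R R ` L) = R ` rel_ker L"
proof -
  interpret R: Vector_Spaces.linear scaleC scaleC R by (rule R)
  have "R y = 0 \<longleftrightarrow> y = 0" for y by (metis R.zero inj injD)
  then show ?thesis by (force simp: rel_ker_def)
qed

lemma pencil_point_spectrum_pencil_at:
  "pencil_point_spectrum E D A = {z. op_ker D (pencil_at E A z) \<noteq> {0}}"
proof -
  have "op_ker UNIV E \<inter> D = op_ker D E" by (auto simp: op_ker_def)
  then show ?thesis
    by (auto simp: pencil_point_spectrum_def pencil_at_def split: extended_complex.splits)
qed

lemma pencil_essential_spectrum_pencil_at:
  "pencil_essential_spectrum E D A = {z. \<not> fredholm D (pencil_at E A z)}"
  by (auto simp: pencil_essential_spectrum_def pencil_at_def split: extended_complex.splits)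

section \<open>Pencils with an invertible value\<close>

lemma scaleC_diff: "(a - b) *\<^sub>C x = a *\<^sub>C x - b *\<^sub>C (x :: 'a::complex_vector)"
  "a *\<^sub>C (x - y) = a *\<^sub>C x - a *\<^sub>C (y :: 'a::complex_vector)"
  by (rule complex_vector.scale_left_diff_distrib complex_vector.scale_right_diff_distrib)+

locale regular_pencil =
  fixes E :: "'x::cbanach \<Rightarrow> 'y::cbanach" and A :: "'x \<Rightarrow> 'y" and D :: "'x set" and \<mu> :: complex
  assumes bounded_E: "bounded_clinear E"
    and closed_A: "closed_operator D A"
    and bij: "bij_betw (pencil E A \<mu>) D UNIV"
begin

definition R :: "'y \<Rightarrow> 'x" where
  "R = inv_into D (pencil E A \<mu>)"

lemma linear_operators:
  "linear_operator UNIV E" "linear_operator D A" "csubspace D" "bounded_linear E"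
  using bounded_clinear_linear_operator[OF bounded_E] closed_A
  by (auto simp: closed_operator_def linear_operator_def)

lemma E_simps: "E (x + y) = E x + E y" "E (x - y) = E x - E y" "E (c *\<^sub>C x) = c *\<^sub>C E x" "E 0 = 0"
  using linear_operators(1) linear_operator_diff(2)[OF linear_operators(1)]
    linear_operator_zero(2)[OF linear_operators(1)]
  by (auto simp: linear_operator_def)

lemma A_simps: "x \<in> D \<Longrightarrow> y \<in> D \<Longrightarrow> A (x + y) = A x + A y"
  "x \<in> D \<Longrightarrow> y \<in> D \<Longrightarrow> A (x - y) = A x - A y" "x \<in> D \<Longrightarrow> A (c *\<^sub>C x) = c *\<^sub>C A x" "A 0 = 0"
  using linear_operators(2) linear_operator_diff(2)[OF linear_operators(2)]
    linear_operator_zero(2)[OF linear_operators(2)]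
  by (auto simp: linear_operator_def)

lemma D_simps: "0 \<in> D" "x \<in> D \<Longrightarrow> y \<in> D \<Longrightarrow> x + y \<in> D"
  "x \<in> D \<Longrightarrow> y \<in> D \<Longrightarrow> x - y \<in> D" "x \<in> D \<Longrightarrow> c *\<^sub>C x \<in> D"
  using linear_operators(3) complex_vector.subspace_0 complex_vector.subspace_add
    complex_vector.subspace_diff complex_vector.subspace_scale by blast+

lemma closed_operator_pencil: "closed_operator D (pencil E A \<zeta>)"
proof -
  interpret E: bounded_linear E by (rule linear_operators(4))
  interpret C: bounded_linear "\<lambda>x. \<zeta> *\<^sub>C x :: 'y" by (rule cbanach_scaleC_bounded_linear)
  have "{(x, pencil E A \<zeta> x) | x. x \<in> D} =
    (\<lambda>p. (fst p, \<zeta> *\<^sub>C E (fst p) - snd p)) -` {(x, A x) | x. x \<in> D}"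
  proof -
    have "u - y = v \<longleftrightarrow> y = u - v" for u v y :: 'y by (auto simp: algebra_simps)
    then show ?thesis by (auto simp: pencil_def)
  qed
  moreover have "closed ((\<lambda>p. (fst p, \<zeta> *\<^sub>C E (fst p) - snd p)) -` {(x, A x) | x. x \<in> D})"
    using closed_A unfolding closed_operator_def
    by (intro closed_vimage continuous_intros C.continuous_on E.continuous_on) auto
  ultimately show ?thesis
    using linear_operators(3)
    by (auto simp: closed_operator_def linear_operator_def pencil_def E_simps A_simps D_simps
        scaleC_add_right scaleC_diff scaleC_scaleC mult.commute)
qed

lemma linear_pencil_at: "linear_operator D (pencil_at E A z)"
  using closed_operator_pencil linear_operators
  by (auto simp: closed_operator_def pencil_at_def linear_operator_def split: extended_complex.splits)

lemma boundedly_invertible_regular: "boundedly_invertible D (pencil E A \<mu>)"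
  using closed_operator_boundedly_invertible_iff[OF closed_operator_pencil] bij by blast

lemma bounded_R: "bounded_clinear R"
  using boundedly_invertible_regular by (simp add: boundedly_invertible_def R_def)

lemma R_in: "R y \<in> D"
  using bij_betw_inv_into[OF bij] by (auto simp: R_def bij_betw_def)

lemma pencil_R: "pencil E A \<mu> (R y) = y"
  using bij_betw_inv_into_right[OF bij] by (simp add: R_def)

lemma R_pencil: "x \<in> D \<Longrightarrow> R (pencil E A \<mu> x) = x"
  using bij_betw_inv_into_left[OF bij] by (simp add: R_def)

lemma A_R: "A (R y) = \<mu> *\<^sub>C E (R y) - y"
  using pencil_R[of y] by (simp add: pencil_def algebra_simps)

lemma linear_R: "Vector_Spaces.linear scaleC scaleC R"
  using bounded_R by (simp add: bounded_clinear_def)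

lemma inj_R: "inj R"
  by (rule inj_on_inverseI) (rule pencil_R)

lemma range_R: "range R = D"
proof
  show "range R \<subseteq> D" using R_in by blast
  show "D \<subseteq> range R"
  proof
    fix x assume "x \<in> D"
    from R_pencil[OF this] show "x \<in> range R" by (metis rangeI)
  qed
qed

lemma mem_R_image_iff: "x \<in> R ` V \<longleftrightarrow> x \<in> D \<and> pencil E A \<mu> x \<in> V"
proof
  assume "x \<in> R ` V"
  then show "x \<in> D \<and> pencil E A \<mu> x \<in> V" by (auto simp: R_in pencil_R)
next
  assume x: "x \<in> D \<and> pencil E A \<mu> x \<in> V"
  then show "x \<in> R ` V" using imageI[of "pencil E A \<mu> x" V R] by (simp add: R_pencil)
qed

text \<open>
  The regular value is continuous for the graph norm because \<open>E\<close> and \<open>A\<close> are, and its inverse is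
  continuous into the graph norm because \<open>R\<close> and \<open>A R = \<mu> E R - 1\<close> are bounded.
\<close>

lemma closedin_R_image_iff:
  "closedin (norm_topology D (graph_norm A)) (R ` V) \<longleftrightarrow> closed V"
proof -
  let ?T = "norm_topology D (graph_norm A)"
  note lin = linear_operators(2)
  interpret E: bounded_linear E by (rule linear_operators(4))
  interpret C: bounded_linear "\<lambda>x. \<mu> *\<^sub>C x :: 'y" by (rule cbanach_scaleC_bounded_linear)
  have idc: "continuous_map ?T euclidean (\<lambda>x. x)" and Ac: "continuous_map ?T euclidean A"
    by (intro continuous_map_graph_topology lin; simp)+
  have "continuous_map ?T euclidean (\<lambda>x. \<mu> *\<^sub>C E x)"
    using continuous_map_compose[OF idc, of euclidean "\<lambda>x. \<mu> *\<^sub>C E x"]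
    by (simp add: o_def C.continuous_on E.continuous_on continuous_on_id)
  then have Mc: "continuous_map ?T euclidean (pencil E A \<mu>)"
    unfolding pencil_def by (intro continuous_map_diff Ac)
  interpret R: bounded_linear R by (rule bounded_clinear_linear_operator(2)[OF bounded_R])
  have "bounded_linear (\<lambda>y. \<mu> *\<^sub>C E (R y) - y)"
    by (intro bounded_linear_sub bounded_linear_ident bounded_linear_compose[OF C.bounded_linear_axioms]
        bounded_linear_compose[OF E.bounded_linear_axioms] R.bounded_linear_axioms)
  then interpret AR: bounded_linear "\<lambda>y. A (R y)" by (simp add: A_R)
  have Rc: "continuous_map euclidean ?T R"
  proof -
    have "continuous_map (Metric_space.mtopology UNIV dist)
        (Metric_space.mtopology D (norm_dist D (graph_norm A))) R"
      unfolding Metric_space.metric_continuous_map[OF Met_TC.Metric_space_axioms graph_norm_Metric_space[OF lin]]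
    proof (intro conjI ballI allI impI)
      show "R ` UNIV \<subseteq> D" by (simp add: range_R)
    next
      fix a and e :: real assume "e > 0"
      have "((\<lambda>y. dist (R a) (R y) + dist (A (R a)) (A (R y))) \<longlongrightarrow> dist (R a) (R a) + dist (A (R a)) (A (R a))) (at a)"
        by (intro tendsto_intros R.tendsto AR.tendsto)
      then have "\<forall>\<^sub>F y in at a. dist (R a) (R y) + dist (A (R a)) (A (R y)) < e"
        using \<open>e > 0\<close> by (simp add: order_tendstoD)
      then show "\<exists>d>0. \<forall>x. x \<in> UNIV \<and> dist a x < d \<longrightarrow> norm_dist D (graph_norm A) (R a) (R x) < e"
        using \<open>e > 0\<close> unfolding eventually_at norm_dist_graph_norm[OF lin R_in R_in]
        by (metis UNIV_I add_0 dist_commute dist_self)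
    qed
    then show ?thesis by (simp add: norm_topology_def mtopology_is_euclidean)
  qed
  show ?thesis
  proof
    assume "closedin ?T (R ` V)"
    then have "closedin euclidean {y \<in> topspace euclidean. R y \<in> R ` V}"
      by (rule closedin_continuous_map_preimage[OF Rc])
    then show "closed V" by (simp add: inj_image_mem_iff[OF inj_R])
  next
    assume "closed V"
    then have "closedin ?T {x \<in> topspace ?T. pencil E A \<mu> x \<in> V}"
      by (intro closedin_continuous_map_preimage[OF Mc]) simp
    moreover have "{x \<in> topspace ?T. pencil E A \<mu> x \<in> V} = R ` V"
      by (simp only: topspace_graph_topology[OF lin] set_eq_iff mem_R_image_iff mem_Collect_eq) simp
    ultimately show "closedin ?T (R ` V)" by simp
  qed
qed

text \<open>
  At a finite point, shifting the relation gives the pencil with the opposite sign, which does not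
  change its range.
\<close>

lemma Range_range_rep: "Range (rel_at (range_rep E D A) z) = pencil_at E A z ` D"
proof (cases z)
  case (Fin \<zeta>)
  have V: "csubspace (pencil E A \<zeta> ` D)"
    using csubspace_image[OF linear_pencil_at[of z]] by (simp add: Fin pencil_at_def)
  have "Range (rel_at (range_rep E D A) z) = uminus ` pencil E A \<zeta> ` D"
    unfolding Fin rel_at_def range_rep_def rel_shift_def pencil_def image_image by force
  also have "\<dots> = pencil E A \<zeta> ` D"
  proof (rule set_eqI)
    fix v
    have "v \<in> uminus ` pencil E A \<zeta> ` D \<longleftrightarrow> - v \<in> pencil E A \<zeta> ` D"
      by (metis (no_types, lifting) image_iff minus_minus)
    then show "v \<in> uminus ` pencil E A \<zeta> ` D \<longleftrightarrow> v \<in> pencil E A \<zeta> ` D"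
      by (simp only: csubspace_uminus_iff[OF V])
  qed
  finally show ?thesis by (simp add: Fin pencil_at_def)
next
  case Infty
  then show ?thesis by (auto simp: rel_at_def range_rep_def pencil_at_def)
qed

lemma rel_ker_kernel_rep:
  "rel_ker (rel_at (kernel_rep E D A) z) = op_ker D (pencil_at E A z)"
proof (cases z)
  case (Fin \<zeta>)
  have "rel_ker (rel_at (kernel_rep E D A) z) = {x \<in> D. A x = E (\<zeta> *\<^sub>C x)}"
    unfolding Fin rel_ker_def rel_at_def kernel_rep_def rel_shift_def by (auto simp: D_simps)
  also have "\<dots> = op_ker D (pencil E A \<zeta>)"
    unfolding op_ker_def pencil_def E_simps right_minus_eq by (simp only: eq_commute)
  finally show ?thesis by (simp add: Fin pencil_at_def)
next
  case Infty
  then show ?thesis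
    by (auto simp: rel_ker_def rel_at_def kernel_rep_def pencil_at_def op_ker_def A_simps D_simps)
qed

text \<open>
  The similarity between the two representations. In the operator case \<open>E = 1\<close> it is the fact that
  an operator commutes with its resolvent.
\<close>

theorem kernel_rep_eq_image_range_rep:
  "kernel_rep E D A = map_prod R R ` range_rep E D A"
proof (intro set_eqI iffI)
  fix p assume "p \<in> kernel_rep E D A"
  then obtain x z where p: "p = (x, z)" "x \<in> D" "z \<in> D" "A x = E z"
    by (auto simp: kernel_rep_def)
  \<comment> \<open>solving \<open>x = R (E y)\<close> for \<open>E y = \<mu> E x - A x\<close> and inserting \<open>A x = E z\<close> suggests this \<open>y\<close>\<close>
  define y where "y = \<mu> *\<^sub>C x - z"
  have y: "y \<in> D" using p by (simp add: y_def D_simps)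
  have "E y = pencil E A \<mu> x" "A y = pencil E A \<mu> z"
    using p by (simp_all add: y_def pencil_def E_simps A_simps D_simps)
  then have "p = map_prod R R (E y, A y)" using p by (simp add: R_pencil)
  moreover have "(E y, A y) \<in> range_rep E D A" using y by (auto simp: range_rep_def)
  ultimately show "p \<in> map_prod R R ` range_rep E D A" by blast
next
  fix p assume "p \<in> map_prod R R ` range_rep E D A"
  then obtain y where y: "y \<in> D" and p: "p = (R (E y), R (A y))" by (auto simp: range_rep_def)
  interpret R: Vector_Spaces.linear scaleC scaleC R by (rule linear_R)
  have "E (R (A y)) = E (R (\<mu> *\<^sub>C E y - pencil E A \<mu> y))" by (simp add: pencil_def)
  also have "\<dots> = A (R (E y))" by (simp add: R.diff R.scale R_pencil[OF y] E_simps A_R)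
  finally show "p \<in> kernel_rep E D A" unfolding kernel_rep_def p using R_in by auto
qed

lemma Range_kernel_rep_R:
  "Range (rel_at (kernel_rep E D A) z) = R ` Range (rel_at (range_rep E D A) z)"
  by (simp add: kernel_rep_eq_image_range_rep rel_at_map_prod[OF linear_R] Range_map_prod)

lemma rel_ker_kernel_rep_R:
  "rel_ker (rel_at (kernel_rep E D A) z) = R ` rel_ker (rel_at (range_rep E D A) z)"
  by (simp add: kernel_rep_eq_image_range_rep rel_at_map_prod[OF linear_R]
      rel_ker_map_prod[OF linear_R inj_R])

lemma rel_ker_eq_0_iff:
  "rel_ker (rel_at (range_rep E D A) z) = {0} \<longleftrightarrow> rel_ker (rel_at (kernel_rep E D A) z) = {0}"
proof -
  interpret R: Vector_Spaces.linear scaleC scaleC R by (rule linear_R)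
  have "R ` {0} = {0}" by (simp add: R.zero)
  then show ?thesis unfolding rel_ker_kernel_rep_R by (metis inj_image_eq_iff[OF inj_R])
qed

lemma Range_eq_carrier_iff:
  "Range (rel_at (range_rep E D A) z) = UNIV \<longleftrightarrow> Range (rel_at (kernel_rep E D A) z) = D"
  unfolding Range_kernel_rep_R by (metis inj_image_eq_iff[OF inj_R] range_R)

text \<open>
  The domain \<open>D\<close> need not be closed, so the closed graph theorem does not apply to the inverse of
  \<open>E\<close> on \<open>D\<close>. It applies to \<open>A\<close> composed with that inverse, whose graph is the range
  representation; composing once more with \<open>E\<close> bounds \<open>A\<close>.
\<close>

lemma bounded_operator_if_E_bij:
  assumes "bij_betw E D UNIV"
  shows "bounded_operator D A"
proof -
  let ?F = "inv_into D E"
  have F: "?F y \<in> D" "E (?F y) = y" for y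
    using bij_betw_inv_into_right[OF assms] bij_betw_inv_into[OF assms] by (auto simp: bij_betw_def)
  have FE: "?F (E x) = x" if "x \<in> D" for x using bij_betw_inv_into_left[OF assms that] .
  interpret F: Vector_Spaces.linear scaleC scaleC ?F
    using linear_inv_into[OF linear_pencil_at[of Infty]] assms by (simp add: pencil_at_def)
  have "Vector_Spaces.linear scaleC scaleC (\<lambda>y. A (?F y))"
    by unfold_locales (simp_all add: F.add F.scale A_simps F)
  moreover have "closed {(y, A (?F y)) | y. True}"
  proof -
    have "closed_linear_relation UNIV norm (range_rep E D A)"
      by (rule closed_linear_relation_range_rep[OF bounded_E closed_A boundedly_invertible_regular])
    then have "closed (range_rep E D A)"
      by (simp add: closed_linear_relation_def norm_topology_UNIV_norm euclidean_product_topology)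
    moreover have "range_rep E D A = {(y, A (?F y)) | y. True}"
    proof
      show "range_rep E D A \<subseteq> {(y, A (?F y)) | y. True}"
        unfolding range_rep_def using FE by auto
      show "{(y, A (?F y)) | y. True} \<subseteq> range_rep E D A"
      proof clarify
        fix y
        have "(E (?F y), A (?F y)) \<in> range_rep E D A" using F(1) unfolding range_rep_def by blast
        then show "(y, A (?F y)) \<in> range_rep E D A" by (simp only: F(2))
      qed
    qed
    ultimately show ?thesis by simp
  qed
  ultimately have "bounded_clinear (\<lambda>y. A (?F y))" by (rule bounded_clinear_if_closed_graph)
  then interpret AF: bounded_linear "\<lambda>y. A (?F y)" by (rule bounded_clinear_linear_operator(2))
  interpret E: bounded_linear E by (rule linear_operators(4))
  have "bounded_linear (\<lambda>x. A (?F (E x)))"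
    by (rule bounded_linear_compose[OF AF.bounded_linear_axioms E.bounded_linear_axioms])
  then obtain K where K: "\<And>x. norm (A (?F (E x))) \<le> norm x * K" using bounded_linear.bounded by blast
  have "norm (A x) \<le> K * norm x" if "x \<in> D" for x
    using K[of x] by (simp add: FE[OF that] mult.commute)
  then show ?thesis unfolding bounded_operator_def by blast
qed

text \<open>
  Density matters at infinity: a bounded \<open>A\<close> has a closed domain, which is then the whole
  space, so that bijectivity of \<open>E\<close> on \<open>D\<close> amounts to \<open>E\<close> being invertible and \<open>A\<close> bounded.
\<close>

lemma pencil_resolvent_set_pencil_at:
  assumes dense: "densely_defined D"
  shows "pencil_resolvent_set E D A =
    {z. op_ker D (pencil_at E A z) = {0} \<and> pencil_at E A z ` D = UNIV}"
proof -
  have bounded_domain: "D = UNIV" if "bounded_operator D A"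
    using closed_operator_bounded_domain[OF closed_A that] dense by (simp add: densely_defined_def)
  have "(boundedly_invertible UNIV E \<and> bounded_operator D A) \<longleftrightarrow> bij_betw E D UNIV"
    using bounded_domain bounded_operator_if_E_bij
      closed_operator_boundedly_invertible_iff[OF closed_operator_UNIV[OF bounded_E]] by metis
  then have "pencil_resolvent_set E D A = {z. bij_betw (pencil_at E A z) D UNIV}"
    by (auto simp: pencil_resolvent_set_def pencil_at_def
        closed_operator_boundedly_invertible_iff[OF closed_operator_pencil] split: extended_complex.splits)
  then show ?thesis by (simp add: bij_betw_def inj_on_iff_op_ker[OF linear_pencil_at])
qed

end

theorem proposition3p4:
  fixes E :: "'x::cbanach \<Rightarrow> 'y::cbanach"
    and A :: "'x \<Rightarrow> 'y" and domA :: "'x set"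
  assumes "bounded_clinear E"
    and "closed_operator domA A"
    and "densely_defined domA"
    and "\<exists>\<mu>. bij_betw (pencil E A \<mu>) domA UNIV"
  shows
    "(pencil_spectrum E domA A = rel_spectrum UNIV (range_rep E domA A) \<and>
      rel_spectrum UNIV (range_rep E domA A) = rel_spectrum domA (kernel_rep E domA A)) \<and>
     (pencil_point_spectrum E domA A = rel_point_spectrum (range_rep E domA A) \<and>
      rel_point_spectrum (range_rep E domA A) = rel_point_spectrum (kernel_rep E domA A)) \<and>
     (pencil_essential_spectrum E domA A =
        rel_essential_spectrum UNIV norm (range_rep E domA A) \<and>
      rel_essential_spectrum UNIV norm (range_rep E domA A) =
        rel_essential_spectrum domA (graph_norm A) (kernel_rep E domA A))"
proof -
  obtain \<mu> where "bij_betw (pencil E A \<mu>) domA UNIV" using assms(4) by blast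
  then interpret regular_pencil E A domA \<mu>
    using assms(1,2) by (simp add: regular_pencil_def)
  let ?T = "pencil_at E A" and ?RR = "\<lambda>z. rel_at (range_rep E domA A) z"
    and ?KR = "\<lambda>z. rel_at (kernel_rep E domA A) z"
  have dim: "cfinite_dim (rel_ker (?RR z)) \<longleftrightarrow> cfinite_dim (rel_ker (?KR z))" for z
    unfolding rel_ker_kernel_rep_R by (rule cfinite_dim_inj_image_iff[OF linear_R inj_R, symmetric])
  have codim: "cfinite_codim UNIV (Range (?RR z)) \<longleftrightarrow> cfinite_codim domA (Range (?KR z))" for z
    using cfinite_codim_inj_image_iff[OF linear_R inj_R, of UNIV]
    by (simp add: Range_kernel_rep_R range_R)
  have cl: "closed (Range (?RR z)) \<longleftrightarrow> closedin (norm_topology domA (graph_norm A)) (Range (?KR z))" for z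
    by (simp add: Range_kernel_rep_R closedin_R_image_iff)
  have fred: "fredholm domA (?T z) \<longleftrightarrow> closed (Range (?RR z)) \<and>
      cfinite_dim (rel_ker (?KR z)) \<and> cfinite_codim UNIV (Range (?RR z))" for z
    by (simp add: fredholm_def Range_range_rep rel_ker_kernel_rep)
  have resolvent: "pencil_resolvent_set E domA A =
      {z. rel_ker (?KR z) = {0} \<and> Range (?RR z) = UNIV}"
    by (simp add: pencil_resolvent_set_pencil_at[OF assms(3)] Range_range_rep rel_ker_kernel_rep)
  show ?thesis
    unfolding pencil_spectrum_def resolvent rel_spectrum_def rel_resolvent_set_rel_at
      pencil_point_spectrum_pencil_at rel_point_spectrum_rel_at
      pencil_essential_spectrum_pencil_at rel_essential_spectrum_rel_at
      fred dim codim cl norm_topology_UNIV_norm closed_closedin[symmetric]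
      rel_ker_eq_0_iff Range_eq_carrier_iff rel_ker_kernel_rep[symmetric]
    by simp
qed

end
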